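(* Let $S$ be a finite set of positive integers whose largest element is even. Suppose that $S'\setminus S''$ contains $\ell$ odd elements. Then: (1) If $|S'|=0$, then $\Lambda_S=1$. (2) If $|S'|\ge 1$, then $$\Lambda_{S}(x,y,z,\bar{x},\bar{y},\bar{z}) = (y+\bar{x})(x+\bar{z})^{\ell}\,\Lambda_{S'}(x+1,y,z,\bar{x}+1,\bar{y},\bar{z}) + x^{\ell-1}\left[x(\bar{y}-y) + \ell \bar{x}(z-\bar{z}) - x\bar{x}\right]\Lambda_{S'}(x,y,z,\bar{x},\bar{y},\bar{z}).$$
   Context: Let $S$ be a finite set of positive integers whose largest element $2n$ is even. If $S$ has at least two even elements and $2m$ is its second-largest even element, then $S'$ is obtained from $S$ by removing $2n$ and all odd elements of $S$ between $2m$ and $2n$, i.e. $S'=\{s\in S: s\le 2m\}$; if $S$ has only one even element, $S'=\emptyset$. $S''=(S')'$ (with $\emptyset'=\emptyset$). A generalized surjective staircase with domain $S$ is a surjective function $F$ from $S$ onto the set of even elements of $S$ with $F(a)\ge a$ for all $a\in S$. $\mathcal{E}_S$ is the set of all of these. For $F\in\mathcal{E}_S$ define: - An odd $2i-1\in S'$ is a surfixed point of $F$ if $F(2i-1)$ is the least even element of $S$ larger than $2i-1$. It is isolated if there is no $j\in S$, $j\neq 2i-1$, with $F(j)=F(2i-1)$, and doubled otherwise. $\mathrm{si}(F)$ and $\mathrm{sd}(F)$ are the numbers of isolated and doubled surfixed points. - An even $2i\in S'$ is a fixed point of $F$ if $F(2i)=2i$. It is isolated if there is no $j\in S$, $j\ne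 2i$, with $F(j)=2i$, and doubled otherwise. $\mathrm{fi}(F)$ and $\mathrm{fd}(F)$ are the numbers of isolated and doubled fixed points. - An odd (respectively even) element $a\in S'$ is an odd (respectively even) maximum of $F$ if $F(a)=2n=\max S$. $\mathrm{mo}(F)$ and $\mathrm{me}(F)$ are the numbers of odd and even maxima. Elements of $S\setminus S'$ do not count for any statistic. In commuting variables $x,y,z,\bar x,\bar y,\bar z$, $$\Lambda_S(x,y,z,\bar x,\bar y,\bar z)=\sum_{F\in\mathcal{E}_S}x^{\mathrm{mo}(F)}y^{\mathrm{fd}(F)}z^{\mathrm{si}(F)}\bar x^{\mathrm{me}(F)}\bar y^{\mathrm{fi}(F)}\bar z^{\mathrm{sd}(F)}.$$ When $\ell=0$, the factor $x^{\ell-1}[x(\bar y-y)+\ell\bar x(z-\bar z)-x\bar x]$ means $\bar y-y-\bar x$ (the $x^{-1}$ cancels). *)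

theory Defs
  imports Complex_Main "HOL-Library.FuncSet"
begin

definition evens :: "nat set \<Rightarrow> nat set" where
  "evens S = {s \<in> S. even s}"

text \<open>The set \<open>S'\<close>. The element \<open>Max (evens S - {Max (evens S)})\<close> is the second-largest even
  element of \<open>S\<close>. The intended arguments are the empty set and finite sets whose largest
  element is even.\<close>

definition trunc :: "nat set \<Rightarrow> nat set" where
  "trunc S =
     (if card (evens S) \<ge> 2 then {s \<in> S. s \<le> Max (evens S - {Max (evens S)})} else {})"

text \<open>Extensional functions (\<open>undefined\<close> outside \<open>S\<close>) are used so that each function with
  domain \<open>S\<close> is represented exactly once.\<close>

definition staircases :: "nat set \<Rightarrow> (nat \<Rightarrow> nat) set" where
  "staircases S =
     {F \<in> S \<rightarrow>\<^sub>E evens S. F ` S = evens S \<and> (\<forall>a\<in>S. F a \<ge> a)}"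

definition surfixed_points :: "nat set \<Rightarrow> (nat \<Rightarrow> nat) \<Rightarrow> nat set" where
  "surfixed_points S F = {a \<in> trunc S. odd a \<and> F a = Min {b \<in> evens S. a < b}}"

definition fixed_points :: "nat set \<Rightarrow> (nat \<Rightarrow> nat) \<Rightarrow> nat set" where
  "fixed_points S F = {a \<in> trunc S. even a \<and> F a = a}"

definition isolated :: "nat set \<Rightarrow> (nat \<Rightarrow> nat) \<Rightarrow> nat \<Rightarrow> bool" where
  "isolated S F a \<longleftrightarrow> \<not> (\<exists>j\<in>S. j \<noteq> a \<and> F j = F a)"

definition si :: "nat set \<Rightarrow> (nat \<Rightarrow> nat) \<Rightarrow> nat" where
  "si S F = card {a \<in> surfixed_points S F. isolated S F a}"

definition sd :: "nat set \<Rightarrow> (nat \<Rightarrow> nat) \<Rightarrow> nat" where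
  "sd S F = card {a \<in> surfixed_points S F. \<not> isolated S F a}"

definition fi :: "nat set \<Rightarrow> (nat \<Rightarrow> nat) \<Rightarrow> nat" where
  "fi S F = card {a \<in> fixed_points S F. isolated S F a}"

definition fd :: "nat set \<Rightarrow> (nat \<Rightarrow> nat) \<Rightarrow> nat" where
  "fd S F = card {a \<in> fixed_points S F. \<not> isolated S F a}"

definition mo :: "nat set \<Rightarrow> (nat \<Rightarrow> nat) \<Rightarrow> nat" where
  "mo S F = card {a \<in> trunc S. odd a \<and> F a = Max S}"

definition me :: "nat set \<Rightarrow> (nat \<Rightarrow> nat) \<Rightarrow> nat" where
  "me S F = card {a \<in> trunc S. even a \<and> F a = Max S}"

text \<open>The polynomial \<open>\<Lambda>\<^sub>S\<close> is given by its value at six elements of an arbitrary commutative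
  ring; an identity holding for all values in all commutative rings is the same as an identity
  of polynomials with integer coefficients (take the polynomial ring itself and its
  indeterminates). \<open>xb\<close>, \<open>yb\<close>, \<open>zb\<close> are the barred variables.\<close>

definition Lam ::
  "nat set \<Rightarrow> 'a \<Rightarrow> 'a \<Rightarrow> 'a \<Rightarrow> 'a \<Rightarrow> 'a \<Rightarrow> 'a \<Rightarrow> 'a::comm_ring_1" where
  "Lam S x y z xb yb zb =
     (\<Sum>F\<in>staircases S.
        x ^ mo S F * y ^ fd S F * z ^ si S F * xb ^ me S F * yb ^ fi S F * zb ^ sd S F)"

text \<open>The factor \<open>x\<^bsup>l-1\<^esup> [x (yb - y) + l xb (z - zb) - x xb]\<close>; for \<open>l = 0\<close> the bracket is
  a multiple of \<open>x\<close>, and the factor stands for what remains after cancelling \<open>x\<^bsup>-1\<^esup>\<close>.\<close>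

definition corr_factor ::
  "nat \<Rightarrow> 'a \<Rightarrow> 'a \<Rightarrow> 'a \<Rightarrow> 'a \<Rightarrow> 'a \<Rightarrow> 'a \<Rightarrow> 'a::comm_ring_1" where
  "corr_factor l x y z xb yb zb =
     (if l = 0 then yb - y - xb
      else x ^ (l - 1) * (x * (yb - y) + of_nat l * xb * (z - zb) - x * xb))"

end

theory Submission
  imports Defs
begin

text \<open>
  Write \<open>T\<close> for \<open>S'\<close>, \<open>p = Max S\<close> and \<open>q = Max T\<close>. In a staircase \<open>F\<close> with domain \<open>S\<close> all elements
  of \<open>S - T\<close> are forced to go to \<open>p\<close>. Replacing the value \<open>p\<close> by \<open>q\<close> on \<open>T\<close> turns \<open>F\<close> into a
  staircase \<open>G\<close> with domain \<open>T\<close>; conversely \<open>F\<close> is recovered from \<open>G\<close> and the set \<open>B\<close> of those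
  elements of the fibre \<open>M\<close> of \<open>G\<close> over \<open>q\<close> that keep the value \<open>q\<close>. The only constraint on
  \<open>B \<subseteq> M\<close> is that \<open>F\<close> still hits \<open>q\<close>, that is \<open>B \<noteq> {}\<close>. This is the bijection
  \<open>bij_betw_raise\<close>.

  The monomial of a staircase is a product of local factors over \<open>T\<close>. Outside \<open>M\<close> the factors of
  \<open>F\<close> and \<open>G\<close> agree. On \<open>M\<close>, an element moved to \<open>p\<close> contributes \<open>x\<close> or \<open>xb\<close> according to its
  parity, and an element of \<open>B\<close> contributes \<open>y\<close> (if it is \<open>q\<close>), \<open>zb\<close> (if it is odd and outside
  \<open>T'\<close>) or \<open>1\<close> (if it is a maximum of \<open>G\<close>), except that a \<open>B\<close> with just one element
  turns \<open>y\<close> into \<open>yb\<close> and \<open>zb\<close> into \<open>z\<close>. Without this exception, the sum over all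
  \<open>B \<subseteq> M\<close> is the expansion of \<open>(y + xb) (x + zb)\<^sup>l\<close> times the monomial of \<open>G\<close> with \<open>x\<close> and \<open>xb\<close>
  increased by \<open>1\<close>. Removing \<open>B = {}\<close> and correcting the one-element sets gives the second
  summand; this is \<open>sum_nonempty_subsets\<close>.
\<close>

section \<open>Truncation of a set with even maximum\<close>

lemma trunc_subset: "trunc R \<subseteq> R"
  by (auto simp: trunc_def)

lemma evens_trunc: "evens (trunc R) = evens R \<inter> trunc R"
  by (auto simp: trunc_def evens_def)

locale even_topped =
  fixes R :: "nat set"
  assumes fin: "finite R" and nonempty: "R \<noteq> {}" and even_Max: "even (Max R)"
begin

lemma Max_in_evens: "Max R \<in> evens R"
  using fin nonempty even_Max by (auto simp: evens_def)

lemma finite_evens: "finite (evens R)"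
  using fin by (simp add: evens_def)

lemma Max_evens: "Max (evens R) = Max R"
  using fin Max_in_evens finite_evens by (intro Max_eqI) (auto simp: evens_def)

lemma finite_trunc: "finite (trunc R)"
  using fin trunc_subset finite_subset by blast

lemma trunc_less: "a \<in> R - trunc R \<Longrightarrow> b \<in> trunc R \<Longrightarrow> b < a"
  by (auto simp: trunc_def split: if_splits)

lemma trunc_structure:
  shows trunc_less_Max: "a \<in> trunc R \<Longrightarrow> a < Max R"
    and evens_eq_insert_Max: "evens R = insert (Max R) (evens (trunc R))"
    and even_Max_trunc: "trunc R \<noteq> {} \<Longrightarrow> even (Max (trunc R))"
proof -
  define E where "E = evens R - {Max R}"
  have E: "finite E" "E \<subseteq> R" "\<And>e. e \<in> E \<Longrightarrow> e < Max R \<and> even e"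
  proof -
    show "finite E" "E \<subseteq> R"
      using finite_evens by (auto simp: E_def evens_def)
    show "e < Max R \<and> even e" if "e \<in> E" for e
      using that le_neq_implies_less[OF Max_ge[OF fin]] by (auto simp: E_def evens_def)
  qed
  have ev: "evens R = insert (Max R) E"
    using Max_in_evens by (auto simp: E_def)
  have cardE: "card (evens R) = Suc (card E)"
    using E(1,3) unfolding ev by (metis card_insert_disjoint less_irrefl)
  have "card (evens R) \<ge> 2 \<longleftrightarrow> E \<noteq> {}"
    using cardE card_gt_0_iff[of E] E(1) by linarith
  then have tr: "trunc R = (if E = {} then {} else {s \<in> R. s \<le> Max E})"
    unfolding trunc_def Max_evens E_def[symmetric] by presburger
  have mE: "Max E \<in> E" "trunc R = {s \<in> R. s \<le> Max E}" if "E \<noteq> {}"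
    using that E(1) tr by simp_all
  show less: "a < Max R" if a: "a \<in> trunc R" for a
  proof -
    have "E \<noteq> {}" using a tr by force
    then have "a \<le> Max E" "Max E < Max R" using a mE E(3) by blast+
    then show ?thesis by simp
  qed
  show "even (Max (trunc R))" if "trunc R \<noteq> {}"
  proof -
    have ne: "E \<noteq> {}" using that tr by force
    have "Max (trunc R) = Max E"
      unfolding mE(2)[OF ne] using mE(1)[OF ne] E(2) fin by (intro Max_eqI) auto
    then show ?thesis using E(3)[OF mE(1)[OF ne]] by simp
  qed
  have "E \<subseteq> trunc R"
    using mE(2) E(2) Max_ge[OF E(1)] by blast
  moreover have "evens R \<inter> trunc R \<subseteq> E"
    unfolding ev using less by blast
  ultimately show "evens R = insert (Max R) (evens (trunc R))"
    unfolding evens_trunc using ev by blast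
qed

lemma even_topped_trunc: "trunc R \<noteq> {} \<Longrightarrow> even_topped (trunc R)"
  using finite_trunc even_Max_trunc by unfold_locales auto

text \<open>Above an element outside \<open>R'\<close> the only even element of \<open>R\<close> is the maximum. This forces the
  values of a staircase there.\<close>

lemma evens_above: "a \<in> R - trunc R \<Longrightarrow> b \<in> evens R \<Longrightarrow> a \<le> b \<Longrightarrow> b = Max R"
  using trunc_less[of a b] unfolding evens_eq_insert_Max by (auto simp: evens_def)

lemma next_even_outside:
  assumes "a \<in> R - trunc R" "odd a"
  shows "Min {b \<in> evens R. a < b} = Max R"
proof -
  have "a < Max R"
    using assms even_Max by (intro le_neq_implies_less Max_ge[OF fin]) auto
  then have "{b \<in> evens R. a < b} = {Max R}"
    using evens_above[OF assms(1)] Max_in_evens less_imp_le by blast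
  then show ?thesis by simp
qed

lemma next_even_trunc:
  assumes "a \<in> trunc R" "odd a"
  shows "Min {b \<in> evens R. a < b} = Min {b \<in> evens (trunc R). a < b}"
    and "Min {b \<in> evens R. a < b} < Max R"
proof -
  interpret T: even_topped "trunc R" using even_topped_trunc assms by blast
  let ?X = "{b \<in> evens (trunc R). a < b}"
  have "a < Max (trunc R)"
    using assms T.even_Max by (intro le_neq_implies_less Max_ge[OF T.fin]) auto
  then have ne: "?X \<noteq> {}" "finite ?X"
    using T.Max_in_evens T.finite_evens by auto
  then have "Min ?X \<in> ?X" using Min_in by blast
  then have lt: "Min ?X < Max R"
    using trunc_less_Max by (auto simp: evens_trunc)
  have "{b \<in> evens R. a < b} = insert (Max R) ?X"
    using evens_eq_insert_Max trunc_less_Max[OF assms(1)] by auto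
  then show "Min {b \<in> evens R. a < b} = Min ?X" using ne lt by simp
  then show "Min {b \<in> evens R. a < b} < Max R" using lt by simp
qed

end

section \<open>The monomial of a staircase as a product\<close>

text \<open>Fixed points and surfixed points are treated alike: in both cases \<open>F a\<close> is the least even
  element of \<open>S\<close> that is at least \<open>a\<close>.\<close>

definition fixed_weight ::
  "'a \<Rightarrow> 'a \<Rightarrow> 'a \<Rightarrow> 'a \<Rightarrow> nat set \<Rightarrow> (nat \<Rightarrow> nat) \<Rightarrow> nat \<Rightarrow> 'a::comm_ring_1" where
  "fixed_weight y z yb zb S F a =
     (if F a = (if even a then a else Min {b \<in> evens S. a < b})
      then if isolated S F a then (if even a then yb else z) else (if even a then y else zb)
      else 1)"

definition max_weight :: "'a \<Rightarrow> 'a \<Rightarrow> nat \<Rightarrow> 'a::comm_ring_1" where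
  "max_weight x xb a = (if even a then xb else x)"

definition weight ::
  "'a \<Rightarrow> 'a \<Rightarrow> 'a \<Rightarrow> 'a \<Rightarrow> 'a \<Rightarrow> 'a \<Rightarrow> nat set \<Rightarrow> (nat \<Rightarrow> nat) \<Rightarrow> 'a::comm_ring_1" where
  "weight x y z xb yb zb S F =
     (\<Prod>a\<in>trunc S. if F a = Max S then max_weight x xb a else fixed_weight y z yb zb S F a)"

lemma power_card_filter:
  "finite A \<Longrightarrow> (c::'a::comm_ring_1) ^ card {a \<in> A. P a} = (\<Prod>a\<in>A. if P a then c else 1)"
  by (simp add: prod.inter_filter flip: prod_constant)

text \<open>The six kinds of special elements exclude each other: a fixed or surfixed point in \<open>S'\<close> has a
  value below the maximum.\<close>

lemma (in even_topped) monomial_eq_weight: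
  "x ^ mo R F * y ^ fd R F * z ^ si R F * xb ^ me R F * yb ^ fi R F * zb ^ sd R F
     = weight x y z xb yb zb R F"
proof -
  have filters:
    "{a \<in> surfixed_points R F. isolated R F a} =
       {a \<in> trunc R. odd a \<and> F a = Min {b \<in> evens R. a < b} \<and> isolated R F a}"
    "{a \<in> surfixed_points R F. \<not> isolated R F a} =
       {a \<in> trunc R. odd a \<and> F a = Min {b \<in> evens R. a < b} \<and> \<not> isolated R F a}"
    "{a \<in> fixed_points R F. isolated R F a} = {a \<in> trunc R. even a \<and> F a = a \<and> isolated R F a}"
    "{a \<in> fixed_points R F. \<not> isolated R F a} = {a \<in> trunc R. even a \<and> F a = a \<and> \<not> isolated R F a}"
    by (auto simp: surfixed_points_def fixed_points_def)
  show ?thesis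
    unfolding mo_def me_def fi_def fd_def si_def sd_def filters weight_def
    unfolding power_card_filter[OF finite_trunc] prod.distrib[symmetric]
  proof (rule prod.cong[OF refl])
    fix a assume a: "a \<in> trunc R"
    have "a \<noteq> Max R" "odd a \<Longrightarrow> Min {b \<in> evens R. a < b} \<noteq> Max R"
      using trunc_less_Max[OF a] next_even_trunc(2)[OF a] by auto
    then show "(if odd a \<and> F a = Max R then x else 1)
      * (if even a \<and> F a = a \<and> \<not> isolated R F a then y else 1)
      * (if odd a \<and> F a = Min {b \<in> evens R. a < b} \<and> isolated R F a then z else 1)
      * (if even a \<and> F a = Max R then xb else 1)
      * (if even a \<and> F a = a \<and> isolated R F a then yb else 1)
      * (if odd a \<and> F a = Min {b \<in> evens R. a < b} \<and> \<not> isolated R F a then zb else 1)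
      = (if F a = Max R then max_weight x xb a else fixed_weight y z yb zb R F a)"
      by (cases "even a"; cases "F a = Max R"; cases "isolated R F a")
        (simp_all add: max_weight_def fixed_weight_def)
  qed
qed

lemma (in even_topped) Lam_eq_sum_weight:
  "Lam R x y z xb yb zb = (\<Sum>F\<in>staircases R. weight x y z xb yb zb R F)"
  by (simp add: Lam_def monomial_eq_weight)

text \<open>The factors of the monomial split into those of the maxima, which carry \<open>x\<close> and \<open>xb\<close>, and the
  remaining ones, which do not depend on \<open>x\<close> and \<open>xb\<close>.\<close>

lemma (in even_topped) weight_split:
  assumes "F \<in> staircases R"
  defines "M \<equiv> {a \<in> R. F a = Max R}"
  shows "weight x y z xb yb zb R F =
    (\<Prod>a\<in>R - M. fixed_weight y z yb zb R F a) * (\<Prod>a\<in>M \<inter> trunc R. max_weight x xb a)"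
proof -
  have out: "F a = Max R" if "a \<in> R - trunc R" for a
    using assms that evens_above[OF that, of "F a"] by (auto simp: staircases_def)
  have sets: "trunc R \<inter> - {a. F a = Max R} = R - M" "trunc R \<inter> {a. F a = Max R} = M \<inter> trunc R"
    using out trunc_subset[of R] unfolding M_def by auto
  show ?thesis
    unfolding weight_def prod.If_cases[OF finite_trunc] sets by (simp add: mult.commute)
qed

section \<open>Staircases on \<open>S\<close> from staircases on \<open>S'\<close>\<close>

text \<open>Here \<open>B\<close> collects the elements that keep the value \<open>Max S'\<close>, rather than those that are moved to
  \<open>Max S\<close>: surjectivity then reads \<open>B \<noteq> {}\<close>, and isolation depends only on whether \<open>B\<close> is a
  singleton.\<close>

definition raise :: "nat set \<Rightarrow> (nat \<Rightarrow> nat) \<Rightarrow> nat set \<Rightarrow> nat \<Rightarrow> nat" where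
  "raise S G B =
     (\<lambda>a\<in>S. if a \<in> trunc S \<and> (G a = Max (trunc S) \<longrightarrow> a \<in> B) then G a else Max S)"

definition top_fibre :: "nat set \<Rightarrow> (nat \<Rightarrow> nat) \<Rightarrow> nat set" where
  "top_fibre T G = {a \<in> T. G a = Max T}"

locale truncated = even_topped S for S +
  fixes T :: "nat set"
  assumes T_def: "T = trunc S" and T_nonempty: "T \<noteq> {}"
begin

sublocale T: even_topped T
  using T_def T_nonempty even_topped_trunc by simp

lemma T_subset: "T \<subseteq> S"
  using trunc_subset T_def by simp

lemma Max_less: "Max T < Max S"
  using trunc_less_Max T.fin T_nonempty T_def by simp

lemma evens_S: "evens S = insert (Max S) (evens T)"
  using evens_eq_insert_Max T_def by simp

lemma staircase_le: "G \<in> staircases T \<Longrightarrow> a \<in> T \<Longrightarrow> G a \<le> Max T \<and> a \<le> G a \<and> G a \<in> evens T"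
proof -
  assume "G \<in> staircases T" "a \<in> T"
  then have "G a \<in> evens T" "a \<le> G a" by (auto simp: staircases_def)
  then show ?thesis using T.fin by (simp add: evens_def)
qed

lemma top_fibre_outside: "G \<in> staircases T \<Longrightarrow> T - trunc T \<subseteq> top_fibre T G"
  using T.evens_above staircase_le unfolding top_fibre_def by fast

lemma raise_simps:
  "a \<in> T \<Longrightarrow> raise S G B a = (if G a = Max T \<longrightarrow> a \<in> B then G a else Max S)"
  "a \<in> S - T \<Longrightarrow> raise S G B a = Max S"
  using T_subset by (auto simp: raise_def T_def)

lemma raise_eq_iff:
  assumes "G \<in> staircases T" "B \<subseteq> top_fibre T G" "c \<noteq> Max S"
  shows "a \<in> S \<and> raise S G B a = c \<longleftrightarrow> a \<in> T \<and> G a = c \<and> (c = Max T \<longrightarrow> a \<in> B)"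
  using assms raise_simps[of a G B] T_subset by (cases "a \<in> T") auto

lemma raise_staircase:
  assumes "G \<in> staircases T" "B \<subseteq> top_fibre T G" "B \<noteq> {}"
  shows "raise S G B \<in> staircases S"
proof -
  have val: "raise S G B a \<in> evens S \<and> a \<le> raise S G B a" if "a \<in> S" for a
    using raise_simps[of a G B] staircase_le[OF assms(1), of a] that fin Max_in_evens evens_S
    by (cases "a \<in> T") auto
  moreover have "c \<in> raise S G B ` S" if "c \<in> evens S" for c
  proof (cases "c = Max S")
    case True
    then show ?thesis
      using raise_simps(2)[of "Max S" G B] fin nonempty trunc_less_Max[of "Max S"] T_def
      by (metis Diff_iff Max_in image_eqI less_irrefl)
  next
    case False
    have "\<exists>a \<in> T. G a = c \<and> (c = Max T \<longrightarrow> a \<in> B)"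
    proof (cases "c = Max T")
      case True
      then show ?thesis using assms(2,3) by (auto simp: top_fibre_def)
    next
      case c: False
      have "c \<in> G ` T" using that False assms(1) evens_S by (auto simp: staircases_def)
      then show ?thesis using c by auto
    qed
    then obtain a where "a \<in> S \<and> raise S G B a = c"
      unfolding raise_eq_iff[OF assms(1,2) False] by blast
    then show ?thesis by blast
  qed
  moreover have "raise S G B \<in> extensional S" by (simp add: raise_def)
  ultimately show ?thesis
    unfolding staircases_def by (auto simp: PiE_def)
qed

text \<open>The inverse sends \<open>F\<close> to \<open>min (F a) (Max T)\<close>, restricted to \<open>T\<close>, and to the fibre of \<open>F\<close> over
  \<open>Max T\<close>.\<close>

lemma bij_betw_raise:
  "bij_betw (\<lambda>(G, B). raise S G B)
     (SIGMA G:staircases T. {B. B \<subseteq> top_fibre T G \<and> B \<noteq> {}}) (staircases S)"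
proof (rule bij_betw_byWitness[where
    f' = "\<lambda>F. ((\<lambda>a\<in>T. min (F a) (Max T)), {a \<in> S. F a = Max T})"])
  let ?f' = "\<lambda>F. ((\<lambda>a\<in>T. min (F a) (Max T)), {a \<in> S. F a = Max T})"
  let ?P = "SIGMA G:staircases T. {B. B \<subseteq> top_fibre T G \<and> B \<noteq> {}}"
  show "\<forall>u\<in>?P. ?f' (case u of (G, B) \<Rightarrow> raise S G B) = u"
  proof
    fix u assume "u \<in> ?P"
    then obtain G B where u: "u = (G, B)" and G: "G \<in> staircases T" and B: "B \<subseteq> top_fibre T G"
      by blast
    have "(\<lambda>a\<in>T. min (raise S G B a) (Max T)) = G"
    proof
      fix a
      show "(\<lambda>a\<in>T. min (raise S G B a) (Max T)) a = G a"
      proof (cases "a \<in> T")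
        case True
        then show ?thesis
          using raise_simps(1)[of a G B] staircase_le[OF G, of a] Max_less by auto
      next
        case False
        then have "G a = undefined" using G by (auto simp: staircases_def)
        then show ?thesis using False by simp
      qed
    qed
    moreover have "{a \<in> S. raise S G B a = Max T} = B"
      using raise_eq_iff[OF G B] Max_less B by (auto simp: top_fibre_def)
    ultimately show "?f' (case u of (G, B) \<Rightarrow> raise S G B) = u" by (simp add: u)
  qed
  have F_props: "F a \<in> evens S" "a \<le> F a" if "F \<in> staircases S" "a \<in> S" for F a
    using that by (auto simp: staircases_def)
  have F_out: "F a = Max S" if "F \<in> staircases S" "a \<in> S - T" for F a
    using that F_props[of F a] evens_above[of a "F a"] T_def by simp
  have le_q: "c \<le> Max T" if "c \<in> evens S" "c \<noteq> Max S" for c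
    using that evens_S T.fin by (auto simp: evens_def)
  show "\<forall>F\<in>staircases S. (case ?f' F of (G, B) \<Rightarrow> raise S G B) = F"
  proof
    fix F assume F: "F \<in> staircases S"
    have "raise S (\<lambda>a\<in>T. min (F a) (Max T)) {a \<in> S. F a = Max T} a = F a" for a
    proof (cases "a \<in> S")
      case True
      show ?thesis
      proof (cases "a \<in> T")
        case a: True
        show ?thesis
          using le_q[OF F_props(1)[OF F True]] a True Max_less
          by (cases "F a = Max S") (auto simp: raise_simps)
      next
        case False
        then show ?thesis using True F_out[OF F] by (simp add: raise_simps)
      qed
    next
      case False
      then have "F a = undefined" using F by (auto simp: staircases_def)
      then show ?thesis using False by (simp add: raise_def)
    qed
    then show "(case ?f' F of (G, B) \<Rightarrow> raise S G B) = F" by auto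
  qed
  show "(\<lambda>(G, B). raise S G B) ` ?P \<subseteq> staircases S"
    using raise_staircase by auto
  show "?f' ` staircases S \<subseteq> ?P"
  proof (rule image_subsetI)
    fix F assume F: "F \<in> staircases S"
    define G where "G = (\<lambda>a\<in>T. min (F a) (Max T))"
    have Max_T: "Max T \<in> T" "Max T \<in> evens T" "Max T \<in> evens S"
      using T.Max_in_evens evens_S by (auto simp: evens_def)
    have G: "G a \<in> evens T \<and> a \<le> G a" if "a \<in> T" for a
      using that F_props[OF F, of a] le_q[of "F a"] T_subset Max_less evens_S Max_T T.fin
      by (auto simp: G_def min_def)
    moreover have "c \<in> G ` T" if c: "c \<in> evens T" for c
    proof (cases "c = Max T")
      case True
      then show ?thesis using G[OF Max_T(1)] Max_T(1) T.fin
        by (metis G_def antisym image_eqI min.cobounded2 restrict_apply')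
    next
      case False
      have "c < Max T" using c False T.fin le_neq_implies_less[OF Max_ge[OF T.fin]] by (auto simp: evens_def)
      moreover have "c \<in> F ` S"
        using F c evens_S by (simp add: staircases_def)
      then obtain a where "a \<in> S" "F a = c" by blast
      moreover have "a \<in> T"
        using F_out[OF F, of a] \<open>a \<in> S\<close> \<open>F a = c\<close> \<open>c < Max T\<close> Max_less by auto
      ultimately have "G a = c" by (simp add: G_def)
      then show ?thesis using \<open>a \<in> T\<close> by blast
    qed
    moreover have "G \<in> extensional T" by (simp add: G_def)
    ultimately have 1: "G \<in> staircases T"
      unfolding staircases_def by (auto simp: PiE_def)
    have "Max T \<in> F ` S" using F Max_T(3) by (simp add: staircases_def)
    then have 2: "{a \<in> S. F a = Max T} \<noteq> {}" by auto
    have 3: "{a \<in> S. F a = Max T} \<subseteq> top_fibre T G"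
      using F_out[OF F] Max_less unfolding top_fibre_def G_def by fastforce
    show "?f' F \<in> ?P" unfolding G_def[symmetric] using 1 2 3 by simp
  qed
qed

section \<open>The local factors after raising\<close>

lemma isolated_raise:
  assumes "G \<in> staircases T" "B \<subseteq> top_fibre T G" "a \<in> T" "raise S G B a = c" "c \<noteq> Max S"
  shows "isolated S (raise S G B) a \<longleftrightarrow>
    (\<forall>j \<in> T. j \<noteq> a \<longrightarrow> \<not> (G j = c \<and> (c = Max T \<longrightarrow> j \<in> B)))"
  using raise_eq_iff[OF assms(1,2,5)] assms(4) unfolding isolated_def by metis

text \<open>Values below \<open>Max T\<close> and their fibres are untouched by raising, and the next even element
  after an odd element of \<open>T\<close> is the same in \<open>S\<close> and in \<open>T\<close>.\<close>

lemma fixed_weight_raise_below: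
  assumes "G \<in> staircases T" "B \<subseteq> top_fibre T G" "a \<in> T - top_fibre T G"
  shows "fixed_weight y z yb zb S (raise S G B) a = fixed_weight y z yb zb T G a"
proof -
  have a: "a \<in> T" "G a \<noteq> Max T" "G a \<noteq> Max S"
    using assms(3) staircase_le[OF assms(1), of a] Max_less by (auto simp: top_fibre_def)
  then have r: "raise S G B a = G a" by (simp add: raise_simps)
  have "isolated S (raise S G B) a \<longleftrightarrow> isolated T G a"
    using isolated_raise[OF assms(1,2) a(1) r a(3)] a(2) by (auto simp: isolated_def)
  then show ?thesis
    using next_even_trunc(1)[of a] a(1) r T_def by (simp add: fixed_weight_def)
qed

text \<open>An element that keeps the value \<open>Max T\<close> is special exactly if it lies outside \<open>T'\<close>: the next
  even element after an odd element of \<open>T'\<close> is below \<open>Max T\<close>. It is isolated exactly if no other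
  element has kept the value \<open>Max T\<close>.\<close>

lemma fixed_weight_raise_top:
  assumes "G \<in> staircases T" "B \<subseteq> top_fibre T G" "a \<in> B"
  shows "fixed_weight y z yb zb S (raise S G B) a =
    (if a \<in> trunc T then 1
     else if B = {a} then (if even a then yb else z) else (if even a then y else zb))"
proof -
  have a: "a \<in> T" "G a = Max T" "Max T \<noteq> Max S"
    using assms(2,3) Max_less by (auto simp: top_fibre_def)
  then have r: "raise S G B a = Max T" using assms(3) by (simp add: raise_simps)
  have "isolated S (raise S G B) a \<longleftrightarrow> B = {a}"
    using isolated_raise[OF assms(1,2) a(1) r a(3)] assms(2,3) by (auto simp: top_fibre_def)
  moreover have "Max T = (if even a then a else Min {b \<in> evens S. a < b}) \<longleftrightarrow> a \<notin> trunc T"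
  proof (cases "even a")
    case True
    then have "a \<in> insert (Max T) (evens (trunc T))"
      using a(1) T.evens_eq_insert_Max by (auto simp: evens_def)
    then show ?thesis using True T.trunc_less_Max[of a] by (auto simp: evens_def)
  next
    case False
    have "Min {b \<in> evens S. a < b} = Min {b \<in> evens T. a < b}"
      using next_even_trunc(1)[of a] False a(1) T_def by simp
    then show ?thesis
      using False a(1) T.next_even_outside[of a] T.next_even_trunc(2)[of a] by auto
  qed
  ultimately show ?thesis unfolding fixed_weight_def r by simp
qed

text \<open>Elements of \<open>T\<close> outside the fibre keep their factor, those of \<open>M - B\<close> have become maxima, and
  those of \<open>B\<close> can only be fixed or surfixed points.\<close>

lemma weight_raise:
  assumes G: "G \<in> staircases T" and B: "B \<subseteq> top_fibre T G"
  defines "M \<equiv> top_fibre T G"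
  shows "weight x y z xb yb zb S (raise S G B) =
    (\<Prod>a\<in>T - M. fixed_weight y z yb zb T G a) *
    ((\<Prod>a\<in>M - B. max_weight x xb a) *
     (\<Prod>a\<in>B. if a \<in> trunc T then 1
       else if B = {a} then (if even a then yb else z) else (if even a then y else zb)))"
proof -
  let ?w = "\<lambda>a. if raise S G B a = Max S then max_weight x xb a
      else fixed_weight y z yb zb S (raise S G B) a"
  have M: "M \<subseteq> T" "B \<subseteq> M" "finite M" "finite B"
    using B T.fin finite_subset[of M T] finite_subset[of B M] by (auto simp: M_def top_fibre_def)
  have "weight x y z xb yb zb S (raise S G B) = prod ?w T"
    by (simp add: weight_def T_def)
  also have "\<dots> = prod ?w (T - M) * prod ?w M"
    using M T.fin by (intro prod.subset_diff) auto
  also have "prod ?w M = prod ?w (M - B) * prod ?w B"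
    using M by (intro prod.subset_diff) auto
  also have "prod ?w (T - M) = (\<Prod>a\<in>T - M. fixed_weight y z yb zb T G a)"
  proof (rule prod.cong[OF refl])
    fix a assume a: "a \<in> T - M"
    then have "raise S G B a \<noteq> Max S"
      using staircase_le[OF G, of a] Max_less by (auto simp: raise_simps M_def top_fibre_def)
    then show "?w a = fixed_weight y z yb zb T G a"
      using fixed_weight_raise_below[OF G B] a by (simp add: M_def)
  qed
  also have "prod ?w (M - B) = (\<Prod>a\<in>M - B. max_weight x xb a)"
    using M by (intro prod.cong[OF refl]) (auto simp: raise_simps M_def top_fibre_def)
  also have "prod ?w B = (\<Prod>a\<in>B. if a \<in> trunc T then 1
       else if B = {a} then (if even a then yb else z) else (if even a then y else zb))"
  proof (rule prod.cong[OF refl])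
    fix a assume a: "a \<in> B"
    then have "raise S G B a \<noteq> Max S"
      using B Max_less by (auto simp: raise_simps top_fibre_def)
    then show "?w a = (if a \<in> trunc T then 1
       else if B = {a} then (if even a then yb else z) else (if even a then y else zb))"
      unfolding fixed_weight_raise_top[OF G B a] by (rule if_not_P)
  qed
  finally show ?thesis .
qed

end

section \<open>Summation over the nonempty subsets of a fibre\<close>

text \<open>Were the factor of an element of \<open>B\<close> always \<open>v\<close>, the sum over all \<open>B \<subseteq> M\<close> would be the
  expansion of \<open>\<Prod>a\<in>M. u a + v a\<close>. The other two terms remove \<open>B = {}\<close> and replace \<open>v b\<close> by \<open>t b\<close>
  for \<open>B = {b}\<close>.\<close>

lemma sum_nonempty_subsets:
  fixes u v t :: "'b \<Rightarrow> 'a::comm_ring_1"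
  assumes "finite M"
  shows "(\<Sum>B\<in>{B. B \<subseteq> M \<and> B \<noteq> {}}. (\<Prod>a\<in>M - B. u a) * (\<Prod>a\<in>B. if B = {a} then t a else v a)) =
    (\<Prod>a\<in>M. u a + v a) - (\<Prod>a\<in>M. u a) + (\<Sum>b\<in>M. (t b - v b) * (\<Prod>a\<in>M - {b}. u a))"
proof -
  let ?V = "\<lambda>B. (\<Prod>a\<in>M - B. u a) * (\<Prod>a\<in>B. v a)"
  let ?W = "\<lambda>B. (\<Prod>a\<in>M - B. u a) * (\<Prod>a\<in>B. if B = {a} then t a else v a)"
  let ?N = "{B. B \<subseteq> M \<and> B \<noteq> {}}"
  let ?Z = "(\<lambda>b. {b}) ` M"
  have N: "Pow M = insert {} ?N" "finite ?N" "{} \<notin> ?N"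
    using assms by auto
  have "(\<Prod>a\<in>M. u a + v a) = (\<Prod>a\<in>M. v a + u a)"
    by (simp add: add.commute)
  also have "\<dots> = sum ?V (Pow M)"
    unfolding prod_add[OF assms] by (simp add: mult.commute)
  also have "\<dots> = (\<Prod>a\<in>M. u a) + sum ?V ?N"
    unfolding N(1) sum.insert[OF N(2,3)] by simp
  finally have V: "sum ?V ?N = (\<Prod>a\<in>M. u a + v a) - (\<Prod>a\<in>M. u a)" by simp
  have "sum ?W ?N - sum ?V ?N = (\<Sum>B\<in>?N. ?W B - ?V B)"
    by (simp add: sum_subtractf)
  also have "\<dots> = (\<Sum>B\<in>?Z. ?W B - ?V B)"
  proof (rule sum.mono_neutral_right[OF N(2)])
    show "\<forall>B\<in>?N - ?Z. ?W B - ?V B = 0"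
    proof
      fix B assume "B \<in> ?N - ?Z"
      then have "B \<noteq> {a}" for a by auto
      then show "?W B - ?V B = 0" by simp
    qed
  qed auto
  also have "\<dots> = (\<Sum>b\<in>M. ?W {b} - ?V {b})"
    by (subst sum.reindex) (auto simp: inj_on_def)
  also have "\<dots> = (\<Sum>b\<in>M. (t b - v b) * (\<Prod>a\<in>M - {b}. u a))"
    by (simp add: algebra_simps)
  finally show ?thesis using V by (simp add: algebra_simps)
qed

text \<open>If \<open>t\<close> and \<open>v\<close> are \<open>1\<close> on a part \<open>N\<close> of \<open>M\<close>, that part contributes only a common factor to each
  of the two terms.\<close>

lemma sum_nonempty_subsets_split:
  fixes u v t :: "'b \<Rightarrow> 'a::comm_ring_1"
  assumes "finite N" "finite K" "N \<inter> K = {}"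
  shows "(\<Sum>B\<in>{B. B \<subseteq> N \<union> K \<and> B \<noteq> {}}. (\<Prod>a\<in>(N \<union> K) - B. u a) *
        (\<Prod>a\<in>B. if a \<in> N then 1 else if B = {a} then t a else v a)) =
    (\<Prod>a\<in>N. u a + 1) * (\<Prod>a\<in>K. u a + v a) +
    (\<Prod>a\<in>N. u a) * ((\<Sum>b\<in>K. (t b - v b) * (\<Prod>a\<in>K - {b}. u a)) - (\<Prod>a\<in>K. u a))"
proof -
  let ?t = "\<lambda>a. if a \<in> N then 1 else t a" and ?v = "\<lambda>a. if a \<in> N then 1 else v a"
  have notN: "a \<notin> N" if "a \<in> K" for a using assms(3) that by auto
  have if_eq: "(if a \<in> N then 1 else if B = {a} then t a else v a) =
      (if B = {a} then ?t a else ?v a)" for a B by simp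
  have "(\<Prod>a\<in>N \<union> K. u a + ?v a) = (\<Prod>a\<in>N. u a + 1) * (\<Prod>a\<in>K. u a + v a)"
    using assms notN by (simp add: prod.union_disjoint)
  moreover have "(\<Prod>a\<in>N \<union> K. u a) = (\<Prod>a\<in>N. u a) * (\<Prod>a\<in>K. u a)"
    using assms by (simp add: prod.union_disjoint)
  moreover have "(\<Sum>b\<in>N \<union> K. (?t b - ?v b) * (\<Prod>a\<in>N \<union> K - {b}. u a)) =
      (\<Prod>a\<in>N. u a) * (\<Sum>b\<in>K. (t b - v b) * (\<Prod>a\<in>K - {b}. u a))"
  proof -
    have "(\<Sum>b\<in>N \<union> K. (?t b - ?v b) * (\<Prod>a\<in>N \<union> K - {b}. u a)) =
        (\<Sum>b\<in>K. (?t b - ?v b) * (\<Prod>a\<in>N \<union> K - {b}. u a))"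
      using assms by (simp add: sum.union_disjoint)
    also have "\<dots> = (\<Sum>b\<in>K. (\<Prod>a\<in>N. u a) * ((t b - v b) * (\<Prod>a\<in>K - {b}. u a)))"
    proof (rule sum.cong[OF refl])
      fix b assume b: "b \<in> K"
      have "N \<union> K - {b} = N \<union> (K - {b})" using notN[OF b] by auto
      moreover have "N \<inter> (K - {b}) = {}" using assms(3) by auto
      ultimately show "(?t b - ?v b) * (\<Prod>a\<in>N \<union> K - {b}. u a) =
          (\<Prod>a\<in>N. u a) * ((t b - v b) * (\<Prod>a\<in>K - {b}. u a))"
        using assms notN[OF b] by (simp add: prod.union_disjoint mult_ac)
    qed
    finally show ?thesis by (simp add: sum_distrib_left)
  qed
  ultimately show ?thesis
    unfolding if_eq sum_nonempty_subsets[OF finite_UnI[OF assms(1,2)]]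
    by (simp add: algebra_simps)
qed

section \<open>The recursion\<close>

context truncated
begin

lemma outside_eq:
  obtains Od where "T - trunc T = insert (Max T) Od" "finite Od" "Max T \<notin> Od" "\<forall>a\<in>Od. odd a"
    "card Od = card {s \<in> T - trunc T. odd s}"
proof
  let ?Od = "{s \<in> T - trunc T. odd s}"
  have "Max T \<notin> trunc T" using T.trunc_less_Max by blast
  then show "T - trunc T = insert (Max T) ?Od"
    using T.evens_eq_insert_Max T.Max_in_evens by (auto simp: evens_def)
  show "finite ?Od" "Max T \<notin> ?Od" using T.fin T.even_Max by auto
qed auto

text \<open>The elements of \<open>T - T'\<close> lie in every fibre over \<open>Max T\<close>, so their contribution does not
  depend on \<open>G\<close>. In the second identity, \<open>b = Max T\<close> gives the term with \<open>yb - y\<close>, each odd \<open>b\<close>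
  a term with \<open>z - zb\<close>, and \<open>B = {}\<close> the negative product.\<close>

lemma outside_expansion:
  fixes x y z xb yb zb :: "'a::comm_ring_1"
  assumes l: "card {s \<in> T - trunc T. odd s} = l"
  defines "K \<equiv> T - trunc T"
  shows "(\<Prod>a\<in>K. max_weight x xb a + (if even a then y else zb)) = (y + xb) * (x + zb) ^ l"
    and "(\<Sum>b\<in>K. ((if even b then yb else z) - (if even b then y else zb)) *
           (\<Prod>a\<in>K - {b}. max_weight x xb a)) - (\<Prod>a\<in>K. max_weight x xb a)
         = corr_factor l x y z xb yb zb"
proof -
  obtain Od where Od: "K = insert (Max T) Od" "finite Od" "Max T \<notin> Od" "\<And>a. a \<in> Od \<Longrightarrow> odd a" "card Od = l"
    using outside_eq l unfolding K_def by metis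
  have ev: "even (Max T)" by (rule T.even_Max)
  have "(\<Prod>a\<in>Od. max_weight x xb a + (if even a then y else zb)) = (\<Prod>a\<in>Od. x + zb)"
    by (intro prod.cong[OF refl]) (simp add: max_weight_def Od(4))
  then show "(\<Prod>a\<in>K. max_weight x xb a + (if even a then y else zb)) = (y + xb) * (x + zb) ^ l"
    using Od(2,3,5) ev by (simp add: Od(1) max_weight_def add.commute)
  have powO: "(\<Prod>a\<in>X. max_weight x xb a) = x ^ card X" if "X \<subseteq> Od" for X
  proof -
    have "(\<Prod>a\<in>X. max_weight x xb a) = (\<Prod>a\<in>X. x)"
      using that Od(4) by (intro prod.cong[OF refl]) (auto simp: max_weight_def)
    then show ?thesis by simp
  qed
  have "(\<Sum>b\<in>Od. ((if even b then yb else z) - (if even b then y else zb)) *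
           (\<Prod>a\<in>K - {b}. max_weight x xb a)) = (\<Sum>b\<in>Od. (z - zb) * (xb * x ^ (l - 1)))"
  proof (rule sum.cong[OF refl])
    fix b assume b: "b \<in> Od"
    have "K - {b} = insert (Max T) (Od - {b})" using Od(1,3) b by auto
    then have "(\<Prod>a\<in>K - {b}. max_weight x xb a) = xb * x ^ (l - 1)"
      using Od(2,3,5) b ev powO[of "Od - {b}"] by (simp add: max_weight_def card_Diff_singleton)
    then show "((if even b then yb else z) - (if even b then y else zb)) *
           (\<Prod>a\<in>K - {b}. max_weight x xb a) = (z - zb) * (xb * x ^ (l - 1))"
      using Od(4)[OF b] by simp
  qed
  moreover have "(\<Prod>a\<in>K. max_weight x xb a) = xb * x ^ l"
    using Od(2,3,5) ev powO[of Od] by (simp add: Od(1) max_weight_def)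
  moreover have "K - {Max T} = Od" using Od(1,3) by auto
  ultimately have "(\<Sum>b\<in>K. ((if even b then yb else z) - (if even b then y else zb)) *
           (\<Prod>a\<in>K - {b}. max_weight x xb a)) - (\<Prod>a\<in>K. max_weight x xb a)
      = (yb - y) * x ^ l + of_nat l * ((z - zb) * (xb * x ^ (l - 1))) - xb * x ^ l"
    using Od(2,3,5) ev powO[of Od] by (simp add: Od(1))
  also have "\<dots> = corr_factor l x y z xb yb zb"
    by (cases l) (simp_all add: corr_factor_def algebra_simps)
  finally show "(\<Sum>b\<in>K. ((if even b then yb else z) - (if even b then y else zb)) *
           (\<Prod>a\<in>K - {b}. max_weight x xb a)) - (\<Prod>a\<in>K. max_weight x xb a)
         = corr_factor l x y z xb yb zb" .
qed

lemma sum_weight_raise: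
  fixes x y z xb yb zb :: "'a::comm_ring_1"
  assumes G: "G \<in> staircases T" and l: "card {s \<in> T - trunc T. odd s} = l"
  shows "(\<Sum>B\<in>{B. B \<subseteq> top_fibre T G \<and> B \<noteq> {}}. weight x y z xb yb zb S (raise S G B)) =
    (y + xb) * (x + zb) ^ l * weight (x + 1) y z (xb + 1) yb zb T G +
    corr_factor l x y z xb yb zb * weight x y z xb yb zb T G"
proof -
  define M where "M = top_fibre T G"
  \<comment> \<open>\<open>N\<close> consists of the maxima of \<open>G\<close>, which are counted by the monomial of \<open>G\<close>; \<open>K\<close> is the
    part of the fibre that the statistics of \<open>G\<close> ignore.\<close>
  define N where "N = M \<inter> trunc T"
  define K where "K = T - trunc T"
  define C where "C = (\<Prod>a\<in>T - M. fixed_weight y z yb zb T G a)"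
  define D where "D B = (\<Prod>a\<in>M - B. max_weight x xb a) * (\<Prod>a\<in>B. if a \<in> N then 1
       else if B = {a} then (if even a then yb else z) else (if even a then y else zb))" for B
  have M: "M = N \<union> K" "N \<inter> K = {}" "finite N" "finite K"
    using top_fibre_outside[OF G] T.fin finite_subset[of N T]
    by (auto simp: M_def N_def K_def top_fibre_def)
  have "weight x y z xb yb zb S (raise S G B) = C * D B" if "B \<subseteq> M" for B
  proof -
    have "(\<Prod>a\<in>B. if a \<in> trunc T then 1
       else if B = {a} then (if even a then yb else z) else (if even a then y else zb)) =
      (\<Prod>a\<in>B. if a \<in> N then 1
       else if B = {a} then (if even a then yb else z) else (if even a then y else zb))"
      using that by (intro prod.cong[OF refl]) (auto simp: N_def)
    then show ?thesis
      using weight_raise[OF G, of B x y z xb yb zb] that unfolding C_def D_def M_def by simp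
  qed
  then have "(\<Sum>B\<in>{B. B \<subseteq> M \<and> B \<noteq> {}}. weight x y z xb yb zb S (raise S G B)) =
      C * (\<Sum>B\<in>{B. B \<subseteq> M \<and> B \<noteq> {}}. D B)"
    by (simp add: sum_distrib_left)
  also have "(\<Sum>B\<in>{B. B \<subseteq> M \<and> B \<noteq> {}}. D B) =
      (\<Prod>a\<in>N. max_weight x xb a + 1) * ((y + xb) * (x + zb) ^ l) +
      (\<Prod>a\<in>N. max_weight x xb a) * corr_factor l x y z xb yb zb"
    unfolding D_def M(1) sum_nonempty_subsets_split[OF M(3,4,2)]
    unfolding K_def outside_expansion[OF l] ..
  also have "(\<Prod>a\<in>N. max_weight x xb a + 1) = (\<Prod>a\<in>N. max_weight (x + 1) (xb + 1) a)"
    by (intro prod.cong) (auto simp: max_weight_def)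
  finally show ?thesis
    unfolding T.weight_split[OF G] M_def N_def C_def top_fibre_def
    by (simp only: algebra_simps)
qed

lemma finite_staircases: "finite (staircases T)"
proof (rule finite_subset)
  show "staircases T \<subseteq> T \<rightarrow>\<^sub>E evens T" by (auto simp: staircases_def)
  show "finite (T \<rightarrow>\<^sub>E evens T)" using T.fin T.finite_evens by (intro finite_PiE) auto
qed

lemma Lam_recursion:
  fixes x y z xb yb zb :: "'a::comm_ring_1"
  assumes "card {s \<in> T - trunc T. odd s} = l"
  shows "Lam S x y z xb yb zb =
    (y + xb) * (x + zb) ^ l * Lam T (x + 1) y z (xb + 1) yb zb
    + corr_factor l x y z xb yb zb * Lam T x y z xb yb zb"
proof -
  have fin_B: "\<forall>G\<in>staircases T. finite {B. B \<subseteq> top_fibre T G \<and> B \<noteq> {}}"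
    using T.fin by (auto simp: top_fibre_def)
  have "Lam S x y z xb yb zb =
      (\<Sum>(G, B)\<in>(SIGMA G:staircases T. {B. B \<subseteq> top_fibre T G \<and> B \<noteq> {}}).
        weight x y z xb yb zb S (raise S G B))"
    unfolding Lam_eq_sum_weight sum.reindex_bij_betw[OF bij_betw_raise, symmetric]
    by (simp add: case_prod_unfold)
  also have "\<dots> = (\<Sum>G\<in>staircases T. \<Sum>B\<in>{B. B \<subseteq> top_fibre T G \<and> B \<noteq> {}}.
      weight x y z xb yb zb S (raise S G B))"
    by (rule sum.Sigma[OF finite_staircases fin_B, symmetric])
  finally show ?thesis
    unfolding T.Lam_eq_sum_weight
    using sum_weight_raise[OF _ assms, of _ x y z xb yb zb]
    by (simp add: sum.distrib sum_distrib_left)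
qed

end

lemma (in even_topped) Lam_trunc_empty:
  assumes "trunc R = {}"
  shows "Lam R x y z xb yb zb = 1"
proof -
  have ev: "evens R = {Max R}" using evens_eq_insert_Max assms by (simp add: evens_def)
  have "staircases R = {\<lambda>a\<in>R. Max R}"
  proof
    show "staircases R \<subseteq> {\<lambda>a\<in>R. Max R}"
      by (auto simp: staircases_def ev PiE_def extensional_def fun_eq_iff)
    show "{\<lambda>a\<in>R. Max R} \<subseteq> staircases R"
      using fin nonempty by (auto simp: staircases_def ev)
  qed
  then show ?thesis by (simp add: Lam_eq_sum_weight weight_def assms)
qed

theorem theorem6p4:
  fixes S :: "nat set" and l :: nat
    and x y z xb yb zb :: "'a::comm_ring_1"
  assumes "finite S" and "S \<noteq> {}" and "\<forall>s\<in>S. s > 0" and "even (Max S)"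
    and "card {s \<in> trunc S - trunc (trunc S). odd s} = l"
  shows "(card (trunc S) = 0 \<longrightarrow> Lam S x y z xb yb zb = 1) \<and>
         (card (trunc S) \<ge> 1 \<longrightarrow>
            Lam S x y z xb yb zb =
              (y + xb) * (x + zb) ^ l * Lam (trunc S) (x + 1) y z (xb + 1) yb zb
              + corr_factor l x y z xb yb zb * Lam (trunc S) x y z xb yb zb)"
proof -
  interpret even_topped S using assms by unfold_locales auto
  show ?thesis
  proof (cases "trunc S = {}")
    case True
    then show ?thesis by (simp add: Lam_trunc_empty)
  next
    case False
    then interpret truncated S "trunc S" by unfold_locales auto
    show ?thesis using Lam_recursion[OF assms(5), of x y z xb yb zb] False finite_trunc by simp
  qed
qed

end
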